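(* Let $\mathbb{F}$ be a field of characteristic $0$. A. Suppose that $g(x)=g_0+g_1x+g_2x^2+\cdots\in\mathbb{F}_0[[x]]$ and $F(x)=\omega x+F_2x^2+\cdots\in\mathbb{F}_1[[x]]$. If $\big(g(x),F(x)\big)$ has finite order in the Riordan group $\mathcal{R}=\mathcal{R}(\mathbb{F})$, then $\big(g(x),F(x)\big)$ is conjugate in $\mathcal{R}$ to $(g_0,\omega x)$. Indeed, if $h(x)\in\mathbb{F}_0[[x]]$ satisfies $g(x)=g_0\cdot\frac{h(x)}{h(F(x))}$ (such an $h$ exists), if $b$ is the order of $F(x)$ in $\mathbb{F}_1[[x]]$, and if $\Sigma_F=\frac1b\sum_{j=1}^b\omega^jF^{(b-j)}(x)$, then $$\big(h(x),\Sigma_F\big)^{-1}\,\big(g(x),F(x)\big)\,\big(h(x),\Sigma_F\big)=(g_0,\omega x).$$ B. Suppose that $\big(g(x),F(x)\big)$ and $\big(h(x),K(x)\big)$ are elements of finite order in $\mathcal{R}$, with $g(x)=\sum_{i\ge0}g_ix^i$, $h(x)=\sum_{i\ge0}h_ix^i$, $F(x)=\sum_{j\ge1}f_jx^j$ and $K(x)=\sum_{j\ge1}k_jx^j$. Then $\big(g(x),F(x)\big)$ and $\big(h(x),K(x)\big)$ are conjugate in $\mathcal{R}$ if and only if $g_0=h_0$ and $f_1=k_1$.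
   Context: $\mathbb{F}_0[[x]]$ is the group, under multiplication, of formal power series over $\mathbb{F}$ with nonzero constant term. $\mathbb{F}_1[[x]]$ is the group, under composition, of formal power series $f_1x+f_2x^2+\cdots$ over $\mathbb{F}$ with $f_1\ne0$; its identity is $x$. $F^{(m)}$ denotes the $m$-fold composite of $F$ with itself ($F^{(0)}(x)=x$). The Riordan group $\mathcal{R}(\mathbb{F})$ is the set $\mathbb{F}_0[[x]]\times\mathbb{F}_1[[x]]$ with operation $\big(g(x),F(x)\big)\big(h(x),K(x)\big)=\big(g(x)\cdot h(F(x)),\,K(F(x))\big)$ and identity $(1,x)$. The order of a group element $\gamma$ is the least positive integer $n$ with $\gamma^n$ equal to the identity (infinite order if there is none). *)

theory Defs
  imports
    "HOL-Algebra.Multiplicative_Group"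
    "HOL-Computational_Algebra.Formal_Power_Series"
begin

definition fps_mult_group :: "'a::field fps monoid" where
  "fps_mult_group = \<lparr>carrier = {g. fps_nth g 0 \<noteq> 0}, monoid.mult = (*), one = 1\<rparr>"

definition fps_comp_group :: "'a::field fps monoid" where
  "fps_comp_group =
     \<lparr>carrier = {F. fps_nth F 0 = 0 \<and> fps_nth F 1 \<noteq> 0}, monoid.mult = (oo), one = fps_X\<rparr>"

(* a oo b is the series a(b(x)), so the second component below is K(F(x)). *)
definition riordan_group :: "('a::field fps \<times> 'a fps) monoid" where
  "riordan_group =
     \<lparr>carrier = carrier fps_mult_group \<times> carrier fps_comp_group,
      monoid.mult = (\<lambda>(g, F) (h, K). (g * (h oo F), K oo F)),
      one = (1, fps_X)\<rparr>"

definition conjugate_in :: "('b, 'c) monoid_scheme \<Rightarrow> 'b \<Rightarrow> 'b \<Rightarrow> bool" where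
  "conjugate_in G x y \<longleftrightarrow>
     (\<exists>c\<in>carrier G. inv\<^bsub>G\<^esub> c \<otimes>\<^bsub>G\<^esub> x \<otimes>\<^bsub>G\<^esub> c = y)"

(* Orders are taken with group.ord, whose value 0 encodes infinite order; see pos_ord_iff and
   ord_eq_Least below. *)
definition finite_order :: "('b, 'c) monoid_scheme \<Rightarrow> 'b \<Rightarrow> bool" where
  "finite_order G x \<longleftrightarrow> group.ord G x > 0"

(* Powers in fps_comp_group are the composites F^(m), with F^(0) = x. *)
definition riordan_Sigma :: "'a::field_char_0 fps \<Rightarrow> 'a fps" where
  "riordan_Sigma F =
     (let b = group.ord fps_comp_group F
      in fps_const (1 / of_nat b) *
         (\<Sum>j = 1..b. fps_const (fps_nth F 1 ^ j) * (F [^]\<^bsub>fps_comp_group\<^esub> (b - j))))"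

lemma fps_nth_compose_1:
  fixes F K :: "'a::field fps"
  assumes "fps_nth F 0 = 0"
  shows "fps_nth (K oo F) 1 = fps_nth K 1 * fps_nth F 1"
  using assms by (simp add: fps_compose_nth)

lemma group_fps_mult_group: "group (fps_mult_group :: 'a::field fps monoid)"
proof (rule groupI)
  fix g :: "'a fps" assume "g \<in> carrier fps_mult_group"
  then show "\<exists>h\<in>carrier fps_mult_group. h \<otimes>\<^bsub>fps_mult_group\<^esub> g = \<one>\<^bsub>fps_mult_group\<^esub>"
    by (intro bexI[of _ "inverse g"]) (auto simp: fps_mult_group_def inverse_mult_eq_1)
qed (auto simp: fps_mult_group_def mult.assoc)

lemma fps_inv_in_carrier:
  assumes "F \<in> carrier fps_comp_group"
  shows "fps_inv F \<in> carrier fps_comp_group"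
  using assms by (auto simp: fps_comp_group_def fps_inv_def)

lemma group_fps_comp_group: "group (fps_comp_group :: 'a::field fps monoid)"
proof (rule groupI)
  fix F :: "'a fps" assume F: "F \<in> carrier fps_comp_group"
  then have "fps_inv F oo F = fps_X"
    by (auto simp: fps_comp_group_def intro: fps_inv)
  with fps_inv_in_carrier[OF F]
  show "\<exists>K\<in>carrier fps_comp_group. K \<otimes>\<^bsub>fps_comp_group\<^esub> F = \<one>\<^bsub>fps_comp_group\<^esub>"
    by (intro bexI[of _ "fps_inv F"]) (simp_all add: fps_comp_group_def)
qed (auto simp: fps_comp_group_def fps_nth_compose_1[unfolded One_nat_def] fps_compose_assoc)

lemma group_riordan_group: "group (riordan_group :: ('a::field fps \<times> 'a fps) monoid)"
proof (rule groupI)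
  fix x :: "'a fps \<times> 'a fps" assume x: "x \<in> carrier riordan_group"
  obtain g F where gF: "x = (g, F)" by (cases x)
  have g: "fps_nth g 0 \<noteq> 0" and F: "F \<in> carrier fps_comp_group"
    using x by (auto simp: gF riordan_group_def fps_mult_group_def)
  have K: "fps_inv F \<in> carrier fps_comp_group" by (rule fps_inv_in_carrier[OF F])
  have FK: "F oo fps_inv F = fps_X" and K0: "fps_nth (fps_inv F) 0 = 0"
    using F K by (auto simp: fps_comp_group_def intro: fps_inv_right)
  show "\<exists>y\<in>carrier riordan_group. y \<otimes>\<^bsub>riordan_group\<^esub> x = \<one>\<^bsub>riordan_group\<^esub>"
    using g K FK
    by (intro bexI[of _ "(inverse (g oo fps_inv F), fps_inv F)"])
       (auto simp: gF riordan_group_def fps_mult_group_def inverse_mult_eq_1)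
qed (auto simp: riordan_group_def fps_mult_group_def fps_comp_group_def
       fps_nth_compose_1[unfolded One_nat_def] fps_compose_assoc fps_compose_mult_distrib mult.assoc)

lemma (in group) pos_ord_iff:
  assumes "x \<in> carrier G"
  shows "ord x > 0 \<longleftrightarrow> (\<exists>n>0. x [^] (n::nat) = \<one>)"
  using assms by (metis bot_nat_0.not_eq_extremum dvd_pos_nat pow_eq_id pow_ord_eq_1)

lemma (in group) ord_eq_Least:
  assumes "x \<in> carrier G" "ord x > 0"
  shows "ord x = (LEAST n::nat. n > 0 \<and> x [^] n = \<one>)"
  by (rule Least_equality[symmetric])
     (use assms pow_eq_id in \<open>auto intro: dvd_imp_le\<close>)

end

theory Submission
  imports Defs
begin

text \<open>
  For \<open>(g, F)\<close> in the Riordan group, \<open>c = (h, S)\<close> conjugates \<open>(g, F)\<close> to \<open>(a, \<omega> x)\<close> exactly when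
  \<open>(g, F) c = c (a, \<omega> x)\<close>, that is, when
  \[ g \cdot (h \circ F) = a\,h \qquad\mbox{and}\qquad S \circ F = \omega\,S . \]
  So \<open>h\<close> must be an eigenvector, with eigenvalue \<open>a\<close>, of the weighted composition operator
  \<open>T f = g \<cdot> (f \<circ> F)\<close>, and \<open>S\<close> an eigenvector, with eigenvalue \<open>\<omega>\<close>, of the operator
  \<open>f \<mapsto> f \<circ> F\<close>.  The powers of \<open>(g, F)\<close> and of \<open>F\<close> are the orbits of \<open>(1, x)\<close> and of \<open>x\<close> under these
  operators; if the orders are finite, then the operators are periodic, and an eigenvector with
  eigenvalue \<open>c\<close> is obtained by averaging along the orbit \<open>v, T v, T\<^sup>2 v, \<dots>\<close> with the weights
  \<open>c\<^sup>-\<^sup>k\<close> (\<open>sum_twisted_orbit\<close>).  This requires \<open>c\<^sup>n = 1\<close> for a period \<open>n\<close>, which the lowest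
  coefficients of the \<open>n\<close>-th powers give for \<open>c = g\<^sub>0\<close> and \<open>c = \<omega>\<close>.

  Averaging the orbit of \<open>x\<close> gives exactly \<open>\<Sigma>\<^sub>F\<close>, since \<open>\<omega>\<^sup>b\<^sup>-\<^sup>k = \<omega>\<^sup>-\<^sup>k\<close>; averaging the orbit of \<open>1\<close>
  gives the multiplier \<open>h\<close>.  All terms of either average have the same lowest coefficient, so
  in characteristic \<open>0\<close> it does not vanish and the averages lie in the required groups.  Hence every
  element of finite order is conjugate to the linear element with the same \<open>g\<^sub>0\<close> and \<open>\<omega>\<close>.
  The classification up to conjugacy follows because \<open>(g, F) \<mapsto> (g\<^sub>0, f\<^sub>1)\<close> is a homomorphism to an
  abelian group and so is constant on conjugacy classes.
\<close>

section \<open>Conjugacy as intertwining\<close>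

lemma (in group) conj_eq_iff:
  assumes "c \<in> carrier G" "x \<in> carrier G" "y \<in> carrier G"
  shows "inv c \<otimes> x \<otimes> c = y \<longleftrightarrow> x \<otimes> c = c \<otimes> y"
  using assms by (metis inv_closed inv_solve_left m_assoc m_closed)

lemma (in group) conjugate_in_sym:
  assumes "x \<in> carrier G" "conjugate_in G x y"
  shows "conjugate_in G y x"
proof -
  from assms(2) obtain c where c: "c \<in> carrier G" "y = inv c \<otimes> x \<otimes> c"
    unfolding conjugate_in_def by blast
  have "c \<otimes> (inv c \<otimes> x) = x"
    using c(1) assms(1) by (simp flip: m_assoc)
  then have "inv (inv c) \<otimes> y \<otimes> inv c = x"
    using c assms(1) by (simp add: m_assoc)
  then show ?thesis
    unfolding conjugate_in_def using c(1) by blast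
qed

lemma (in group) conjugate_in_trans:
  assumes "x \<in> carrier G" "conjugate_in G x y" "conjugate_in G y z"
  shows "conjugate_in G x z"
proof -
  from assms(2,3) obtain c d where c: "c \<in> carrier G" "y = inv c \<otimes> x \<otimes> c"
    and d: "d \<in> carrier G" "z = inv d \<otimes> y \<otimes> d"
    unfolding conjugate_in_def by blast
  have "inv (c \<otimes> d) \<otimes> x \<otimes> (c \<otimes> d) = z"
    using c d assms(1) by (simp add: m_assoc inv_mult_group)
  then show ?thesis
    unfolding conjugate_in_def using c(1) d(1) by blast
qed

section \<open>Elements and powers in the Riordan group\<close>

lemma carrier_fps_mult_group_iff: "g \<in> carrier fps_mult_group \<longleftrightarrow> fps_nth g 0 \<noteq> 0"
  by (simp add: fps_mult_group_def)

lemma carrier_fps_comp_group_iff: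
  "F \<in> carrier fps_comp_group \<longleftrightarrow> fps_nth F 0 = 0 \<and> fps_nth F 1 \<noteq> 0"
  by (simp add: fps_comp_group_def)

lemma mem_carrier_riordan_group_iff:
  "(g, F) \<in> carrier riordan_group \<longleftrightarrow> g \<in> carrier fps_mult_group \<and> F \<in> carrier fps_comp_group"
  by (simp add: riordan_group_def)

lemma riordan_mult: "(g, F) \<otimes>\<^bsub>riordan_group\<^esub> (h, K) = (g * (h oo F), K oo F)"
  by (simp add: riordan_group_def)

lemma riordan_one: "\<one>\<^bsub>riordan_group\<^esub> = (1, fps_X)"
  by (simp add: riordan_group_def)

lemma comp_mult: "F \<otimes>\<^bsub>fps_comp_group\<^esub> K = F oo K"
  by (simp add: fps_comp_group_def)

lemma comp_one: "\<one>\<^bsub>fps_comp_group\<^esub> = fps_X"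
  by (simp add: fps_comp_group_def)

text \<open>The order of the factors does not matter for powers, so the second components multiply as in
  the group under composition although the Riordan product composes them in reverse.\<close>

lemma snd_riordan_pow:
  fixes g F :: "'a::field fps"
  assumes F: "F \<in> carrier fps_comp_group"
  shows "snd ((g, F) [^]\<^bsub>riordan_group\<^esub> (k::nat)) = F [^]\<^bsub>fps_comp_group\<^esub> k"
proof (induction k)
  case 0
  show ?case by (simp add: riordan_one comp_one)
next
  case (Suc k)
  interpret C: group "fps_comp_group :: 'a fps monoid" by (rule group_fps_comp_group)
  have "snd ((g, F) [^]\<^bsub>riordan_group\<^esub> Suc k) = F oo snd ((g, F) [^]\<^bsub>riordan_group\<^esub> k)"
    by (cases "(g, F) [^]\<^bsub>riordan_group\<^esub> k") (simp add: riordan_mult)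
  also have "\<dots> = F [^]\<^bsub>fps_comp_group\<^esub> Suc k"
    using C.nat_pow_Suc2[OF F, of k] Suc.IH by (simp add: comp_mult)
  finally show ?case .
qed

text \<open>The first components of the powers of \<open>(g, F)\<close> form the orbit of \<open>1\<close> under the operator
  \<open>f \<mapsto> g \<cdot> (f \<circ> F)\<close>.\<close>

lemma fst_riordan_pow_Suc:
  fixes g F :: "'a::field fps"
  assumes "(g, F) \<in> carrier riordan_group"
  shows "fst ((g, F) [^]\<^bsub>riordan_group\<^esub> Suc k) = g * (fst ((g, F) [^]\<^bsub>riordan_group\<^esub> k) oo F)"
proof -
  interpret R: group "riordan_group :: ('a fps \<times> 'a fps) monoid" by (rule group_riordan_group)
  show ?thesis
    unfolding R.nat_pow_Suc2[OF assms]
    by (cases "(g, F) [^]\<^bsub>riordan_group\<^esub> k") (simp add: riordan_mult)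
qed

lemma fst_riordan_pow_nth_0:
  fixes g F :: "'a::field fps"
  assumes "(g, F) \<in> carrier riordan_group"
  shows "fps_nth (fst ((g, F) [^]\<^bsub>riordan_group\<^esub> k)) 0 = fps_nth g 0 ^ k"
proof (induction k)
  case 0
  show ?case by (simp add: riordan_one)
next
  case (Suc k)
  then show ?case by (simp only: fst_riordan_pow_Suc[OF assms]) simp
qed

lemma comp_pow_nth_1:
  fixes F :: "'a::field fps"
  assumes "F \<in> carrier fps_comp_group"
  shows "fps_nth (F [^]\<^bsub>fps_comp_group\<^esub> (k::nat)) 1 = fps_nth F 1 ^ k"
proof (induction k)
  case 0
  show ?case by (simp add: comp_one)
next
  case (Suc k)
  have "fps_nth F 0 = 0" using assms by (simp add: carrier_fps_comp_group_iff)
  from fps_nth_compose_1[OF this] Suc show ?case by (simp add: comp_mult)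
qed

lemma finite_order_riordan_imp_comp:
  fixes g F :: "'a::field fps"
  assumes gF: "(g, F) \<in> carrier riordan_group" and fin: "finite_order riordan_group (g, F)"
  shows "finite_order fps_comp_group F"
proof -
  have F: "F \<in> carrier fps_comp_group"
    using gF by (simp add: mem_carrier_riordan_group_iff)
  from fin obtain n :: nat where n: "n > 0" "(g, F) [^]\<^bsub>riordan_group\<^esub> n = \<one>\<^bsub>riordan_group\<^esub>"
    unfolding finite_order_def group.pos_ord_iff[OF group_riordan_group gF] by blast
  have "F [^]\<^bsub>fps_comp_group\<^esub> n = \<one>\<^bsub>fps_comp_group\<^esub>"
    using snd_riordan_pow[OF F, of g n] n(2) by (simp add: riordan_one comp_one)
  with n(1) show ?thesis
    unfolding finite_order_def group.pos_ord_iff[OF group_fps_comp_group F] by blast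
qed

section \<open>Eigenvectors by averaging along an orbit\<close>

text \<open>If \<open>v k = T\<^sup>k (v 0)\<close> for a linear operator \<open>T\<close>, then the left-hand side is the image under \<open>T\<close> of
  the sum on the right.  Shifting the index multiplies the weights by \<open>c\<close>, and the boundary term
  returns to its start by periodicity.\<close>

lemma sum_twisted_orbit:
  fixes v :: "nat \<Rightarrow> 'a::field fps"
  assumes "c \<noteq> 0" "c ^ n = 1" "v n = v 0"
  shows "(\<Sum>k<n. fps_const (inverse c ^ k) * v (Suc k))
       = fps_const c * (\<Sum>k<n. fps_const (inverse c ^ k) * v k)"
proof -
  let ?w = "\<lambda>k. fps_const (inverse c ^ k) * v k"
  have step: "fps_const (inverse c ^ k) * v (Suc k) = fps_const c * ?w (Suc k)" for k
  proof -
    have "fps_const c * fps_const (inverse c ^ Suc k) = fps_const (inverse c ^ k)"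
      using assms(1) by (simp add: field_simps)
    then show ?thesis by (metis mult.assoc)
  qed
  have "inverse c ^ n = 1" using assms(2) by (simp add: power_inverse)
  then have wn: "?w n = ?w 0" using assms(3) by simp
  have "?w 0 + (\<Sum>k<n. ?w (Suc k)) = (\<Sum>k<n. ?w k) + ?w n"
    by (simp only: flip: sum.lessThan_Suc_shift[of ?w n] sum.lessThan_Suc[of ?w n])
  also have "\<dots> = ?w 0 + (\<Sum>k<n. ?w k)"
    by (simp only: wn add.commute)
  finally have "(\<Sum>k<n. ?w (Suc k)) = (\<Sum>k<n. ?w k)"
    by (rule add_left_imp_eq)
  then show ?thesis
    by (simp only: step flip: sum_distrib_left)
qed

lemma multiplier_exists:
  fixes g F :: "'a::field_char_0 fps"
  assumes gF: "(g, F) \<in> carrier riordan_group" and fin: "finite_order riordan_group (g, F)"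
  obtains h where "h \<in> carrier fps_mult_group" "g * (h oo F) = fps_const (fps_nth g 0) * h"
proof -
  define c where "c = fps_nth g 0"
  define v where "v k = fst ((g, F) [^]\<^bsub>riordan_group\<^esub> k)" for k :: nat
  have c: "c \<noteq> 0" and F0: "fps_nth F 0 = 0"
    using gF
    by (auto simp: c_def mem_carrier_riordan_group_iff carrier_fps_mult_group_iff
        carrier_fps_comp_group_iff)
  from fin obtain n :: nat where n: "n > 0" "(g, F) [^]\<^bsub>riordan_group\<^esub> n = \<one>\<^bsub>riordan_group\<^esub>"
    unfolding finite_order_def group.pos_ord_iff[OF group_riordan_group gF] by blast
  have vSuc: "v (Suc k) = g * (v k oo F)" for k
    unfolding v_def by (rule fst_riordan_pow_Suc[OF gF])
  have v_nth: "fps_nth (v k) 0 = c ^ k" for k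
    unfolding v_def c_def by (rule fst_riordan_pow_nth_0[OF gF])
  have v0: "v 0 = 1" and vn: "v n = 1"
    using n(2) by (simp_all add: v_def riordan_one)
  have cn: "c ^ n = 1" using v_nth[of n] vn by simp
  define h where "h = (\<Sum>k<n. fps_const (inverse c ^ k) * v k)"
  have "g * (h oo F) = (\<Sum>k<n. fps_const (inverse c ^ k) * v (Suc k))"
    unfolding h_def vSuc fps_compose_sum_distrib sum_distrib_left
    by (rule sum.cong) (simp_all add: fps_compose_mult_distrib[OF F0] mult_ac)
  also have "\<dots> = fps_const c * h"
    unfolding h_def using c cn v0 vn by (intro sum_twisted_orbit) simp_all
  finally have eq: "g * (h oo F) = fps_const c * h" .
  have "fps_nth h 0 = (\<Sum>k<n. inverse c ^ k * c ^ k)"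
    by (simp add: h_def fps_sum_nth v_nth)
  also have "\<dots> = of_nat n"
    using c by (simp flip: power_mult_distrib)
  finally have "h \<in> carrier fps_mult_group"
    using n(1) by (simp add: carrier_fps_mult_group_iff)
  from that[OF this] eq show thesis by (simp add: c_def)
qed

text \<open>The reflection \<open>k = b - j\<close> turns the definition of \<open>\<Sigma>\<^sub>F\<close> into the average along the orbit of \<open>x\<close>,
  because \<open>\<omega>\<^sup>b = 1\<close>.\<close>

lemma riordan_Sigma_orbit_average:
  fixes F :: "'a::field_char_0 fps"
  assumes F: "F \<in> carrier fps_comp_group"
  defines "b \<equiv> group.ord fps_comp_group F"
  shows "riordan_Sigma F = fps_const (1 / of_nat b) *
    (\<Sum>k<b. fps_const (inverse (fps_nth F 1) ^ k) * F [^]\<^bsub>fps_comp_group\<^esub> k)"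
proof -
  let ?\<omega> = "fps_nth F 1"
  have \<omega>: "?\<omega> \<noteq> 0" using F by (simp add: carrier_fps_comp_group_iff)
  have \<omega>b: "?\<omega> ^ b = 1"
    using comp_pow_nth_1[OF F, of b] group.pow_ord_eq_1[OF group_fps_comp_group F]
    by (simp add: b_def comp_one)
  have pow: "inverse ?\<omega> ^ (b - j) = ?\<omega> ^ j" if "j \<le> b" for j
    using that \<omega> \<omega>b by (simp add: power_inverse power_diff)
  have "(\<Sum>j = 1..b. fps_const (?\<omega> ^ j) * F [^]\<^bsub>fps_comp_group\<^esub> (b - j))
      = (\<Sum>k<b. fps_const (inverse ?\<omega> ^ k) * F [^]\<^bsub>fps_comp_group\<^esub> k)"
    by (rule sum.reindex_bij_witness[of _ "\<lambda>k. b - k" "\<lambda>j. b - j"]) (auto simp: pow[unfolded One_nat_def])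
  then show ?thesis by (simp add: riordan_Sigma_def b_def Let_def)
qed

lemma riordan_Sigma_eigenvector:
  fixes F :: "'a::field_char_0 fps"
  assumes F: "F \<in> carrier fps_comp_group" and fin: "finite_order fps_comp_group F"
  shows "riordan_Sigma F \<in> carrier fps_comp_group"
    and "riordan_Sigma F oo F = fps_const (fps_nth F 1) * riordan_Sigma F"
proof -
  interpret C: group "fps_comp_group :: 'a fps monoid" by (rule group_fps_comp_group)
  define b where "b = group.ord fps_comp_group F"
  define v where "v k = F [^]\<^bsub>fps_comp_group\<^esub> k" for k :: nat
  define \<omega> where "\<omega> = fps_nth F 1"
  have b: "b > 0" using fin by (simp add: finite_order_def b_def)
  have \<omega>: "\<omega> \<noteq> 0" and F0: "fps_nth F 0 = 0"
    using F by (auto simp: carrier_fps_comp_group_iff \<omega>_def)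
  have v_nth_0: "fps_nth (v k) 0 = 0" for k
    using C.nat_pow_closed[OF F, of k] by (simp add: v_def carrier_fps_comp_group_iff)
  have v_nth_1: "fps_nth (v k) 1 = \<omega> ^ k" for k
    unfolding v_def \<omega>_def by (rule comp_pow_nth_1[OF F])
  have v0: "v 0 = fps_X" and vb: "v b = fps_X"
    using C.pow_ord_eq_1[OF F] by (simp_all add: v_def b_def comp_one)
  have \<omega>b: "\<omega> ^ b = 1" using v_nth_1[of b] vb by simp
  define S where "S = (\<Sum>k<b. fps_const (inverse \<omega> ^ k) * v k)"
  have Sigma: "riordan_Sigma F = fps_const (1 / of_nat b) * S"
    using riordan_Sigma_orbit_average[OF F] by (simp add: S_def v_def b_def \<omega>_def)
  have "S oo F = (\<Sum>k<b. fps_const (inverse \<omega> ^ k) * v (Suc k))"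
    unfolding S_def fps_compose_sum_distrib
    by (simp add: fps_compose_mult_distrib[OF F0] v_def comp_mult)
  also have "\<dots> = fps_const \<omega> * S"
    unfolding S_def using \<omega> \<omega>b v0 vb by (intro sum_twisted_orbit) simp_all
  finally have "S oo F = fps_const \<omega> * S" .
  then show "riordan_Sigma F oo F = fps_const (fps_nth F 1) * riordan_Sigma F"
    by (simp add: Sigma fps_compose_mult_distrib[OF F0] \<omega>_def mult.left_commute)
  have "fps_nth S 1 = (\<Sum>k<b. inverse \<omega> ^ k * \<omega> ^ k)"
    using v_nth_1 by (simp add: S_def fps_sum_nth)
  also have "\<dots> = of_nat b"
    using \<omega> by (simp flip: power_mult_distrib)
  finally have "fps_nth S 1 = of_nat b" .
  moreover have "fps_nth S 0 = 0"
    by (simp add: S_def fps_sum_nth v_nth_0)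
  ultimately show "riordan_Sigma F \<in> carrier fps_comp_group"
    using b by (simp add: Sigma carrier_fps_comp_group_iff)
qed

section \<open>Linearization and classification\<close>

lemma multiplier_equation_iff:
  fixes g F h :: "'a::field fps"
  assumes "h \<in> carrier fps_mult_group"
  shows "g = fps_const c * (h / (h oo F)) \<longleftrightarrow> g * (h oo F) = fps_const c * h"
proof -
  have u: "fps_nth (h oo F) 0 \<noteq> 0"
    using assms by (simp add: carrier_fps_mult_group_iff)
  have inv: "inverse (h oo F) * (h oo F) = 1" by (rule inverse_mult_eq_1[OF u])
  show ?thesis
    unfolding fps_divide_unit[OF u]
  proof
    assume "g = fps_const c * (h * inverse (h oo F))"
    then have "g * (h oo F) = fps_const c * h * (inverse (h oo F) * (h oo F))"
      by (simp only: mult.assoc)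
    then show "g * (h oo F) = fps_const c * h" by (simp only: inv mult_1_right)
  next
    assume eq: "g * (h oo F) = fps_const c * h"
    have "g = g * (inverse (h oo F) * (h oo F))" by (simp only: inv mult_1_right)
    also have "\<dots> = g * (h oo F) * inverse (h oo F)" by (simp only: mult_ac)
    finally show "g = fps_const c * (h * inverse (h oo F))" by (simp only: eq mult.assoc)
  qed
qed

lemma linear_in_carrier:
  fixes g F :: "'a::field fps"
  assumes "(g, F) \<in> carrier riordan_group"
  shows "(fps_const (fps_nth g 0), fps_const (fps_nth F 1) * fps_X) \<in> carrier riordan_group"
  using assms
  by (simp add: mem_carrier_riordan_group_iff carrier_fps_mult_group_iff
      carrier_fps_comp_group_iff)

text \<open>Any multiplier \<open>h\<close> works together with \<open>\<Sigma>\<^sub>F\<close>: the two eigenvector equations are independent.\<close>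

lemma conj_by_Sigma:
  fixes g F :: "'a::field_char_0 fps"
  assumes gF: "(g, F) \<in> carrier riordan_group" and fin: "finite_order riordan_group (g, F)"
    and h: "h \<in> carrier fps_mult_group" and eq: "g * (h oo F) = fps_const (fps_nth g 0) * h"
  shows "(h, riordan_Sigma F) \<in> carrier riordan_group"
    and "inv\<^bsub>riordan_group\<^esub> (h, riordan_Sigma F) \<otimes>\<^bsub>riordan_group\<^esub> (g, F)
           \<otimes>\<^bsub>riordan_group\<^esub> (h, riordan_Sigma F)
         = (fps_const (fps_nth g 0), fps_const (fps_nth F 1) * fps_X)"
proof -
  have F: "F \<in> carrier fps_comp_group" using gF by (simp add: mem_carrier_riordan_group_iff)
  note Sigma = riordan_Sigma_eigenvector[OF F finite_order_riordan_imp_comp[OF gF fin]]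
  show c: "(h, riordan_Sigma F) \<in> carrier riordan_group"
    using h Sigma(1) by (simp add: mem_carrier_riordan_group_iff)
  have S0: "fps_nth (riordan_Sigma F) 0 = 0"
    using Sigma(1) by (simp add: carrier_fps_comp_group_iff)
  show "inv\<^bsub>riordan_group\<^esub> (h, riordan_Sigma F) \<otimes>\<^bsub>riordan_group\<^esub> (g, F)
          \<otimes>\<^bsub>riordan_group\<^esub> (h, riordan_Sigma F)
        = (fps_const (fps_nth g 0), fps_const (fps_nth F 1) * fps_X)"
    unfolding group.conj_eq_iff[OF group_riordan_group c gF linear_in_carrier[OF gF]]
    by (simp add: riordan_mult eq Sigma(2)[unfolded One_nat_def] fps_compose_mult_distrib[OF S0] S0
        mult.commute)
qed

lemma conjugate_to_linear:
  fixes g F :: "'a::field_char_0 fps"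
  assumes "(g, F) \<in> carrier riordan_group" and "finite_order riordan_group (g, F)"
  shows "conjugate_in riordan_group (g, F)
           (fps_const (fps_nth g 0), fps_const (fps_nth F 1) * fps_X)"
  using multiplier_exists[OF assms] conj_by_Sigma[OF assms] unfolding conjugate_in_def by metis

lemma conjugate_imp_leading_coeffs_eq:
  fixes g F h K :: "'a::field fps"
  assumes gF: "(g, F) \<in> carrier riordan_group" and hK: "(h, K) \<in> carrier riordan_group"
    and conj: "conjugate_in riordan_group (g, F) (h, K)"
  shows "fps_nth g 0 = fps_nth h 0" and "fps_nth F 1 = fps_nth K 1"
proof -
  from conj obtain u S where c: "(u, S) \<in> carrier riordan_group"
    and "inv\<^bsub>riordan_group\<^esub> (u, S) \<otimes>\<^bsub>riordan_group\<^esub> (g, F) \<otimes>\<^bsub>riordan_group\<^esub> (u, S) = (h, K)"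
    unfolding conjugate_in_def by auto
  then have eq: "g * (u oo F) = u * (h oo S)" "S oo F = K oo S"
    unfolding group.conj_eq_iff[OF group_riordan_group c gF hK] by (simp_all add: riordan_mult)
  have nz: "fps_nth u 0 \<noteq> 0" "fps_nth S 1 \<noteq> 0" "fps_nth S 0 = 0" "fps_nth F 0 = 0"
    using c gF
    by (auto simp: mem_carrier_riordan_group_iff carrier_fps_mult_group_iff
        carrier_fps_comp_group_iff)
  show "fps_nth g 0 = fps_nth h 0"
    using arg_cong[OF eq(1), of "\<lambda>f. fps_nth f 0"] nz by simp
  show "fps_nth F 1 = fps_nth K 1"
    using arg_cong[OF eq(2), of "\<lambda>f. fps_nth f 1"] nz(2)
    by (simp only: fps_nth_compose_1[OF nz(3)] fps_nth_compose_1[OF nz(4)]) simp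
qed

lemma conjugate_iff_leading_coeffs_eq:
  fixes g F h K :: "'a::field_char_0 fps"
  assumes gF: "(g, F) \<in> carrier riordan_group" and hK: "(h, K) \<in> carrier riordan_group"
    and fin: "finite_order riordan_group (g, F)" "finite_order riordan_group (h, K)"
  shows "conjugate_in riordan_group (g, F) (h, K) \<longleftrightarrow>
           fps_nth g 0 = fps_nth h 0 \<and> fps_nth F 1 = fps_nth K 1"
proof
  assume "conjugate_in riordan_group (g, F) (h, K)"
  then show "fps_nth g 0 = fps_nth h 0 \<and> fps_nth F 1 = fps_nth K 1"
    using conjugate_imp_leading_coeffs_eq[OF gF hK] by blast
next
  assume "fps_nth g 0 = fps_nth h 0 \<and> fps_nth F 1 = fps_nth K 1"
  then have "conjugate_in riordan_group (g, F)
      (fps_const (fps_nth h 0), fps_const (fps_nth K 1) * fps_X)"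
    using conjugate_to_linear[OF gF fin(1)] by simp
  moreover have "conjugate_in riordan_group
      (fps_const (fps_nth h 0), fps_const (fps_nth K 1) * fps_X) (h, K)"
    by (rule group.conjugate_in_sym[OF group_riordan_group hK conjugate_to_linear[OF hK fin(2)]])
  ultimately show "conjugate_in riordan_group (g, F) (h, K)"
    by (rule group.conjugate_in_trans[OF group_riordan_group gF])
qed

theorem theorem2:
  shows
    "(\<forall>(g::'a::field_char_0 fps) F \<omega>.
        g \<in> carrier fps_mult_group \<and> F \<in> carrier fps_comp_group \<and> fps_nth F 1 = \<omega> \<and>
        finite_order riordan_group (g, F) \<longrightarrow>
          conjugate_in riordan_group (g, F) (fps_const (fps_nth g 0), fps_const \<omega> * fps_X) \<and>
          finite_order fps_comp_group F \<and>
          (\<exists>h\<in>carrier fps_mult_group. g = fps_const (fps_nth g 0) * (h / (h oo F))) \<and>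
          (\<forall>h\<in>carrier fps_mult_group. g = fps_const (fps_nth g 0) * (h / (h oo F)) \<longrightarrow>
             (h, riordan_Sigma F) \<in> carrier riordan_group \<and>
             inv\<^bsub>riordan_group\<^esub> (h, riordan_Sigma F)
               \<otimes>\<^bsub>riordan_group\<^esub> (g, F)
               \<otimes>\<^bsub>riordan_group\<^esub> (h, riordan_Sigma F)
             = (fps_const (fps_nth g 0), fps_const \<omega> * fps_X)))
     \<and>
     (\<forall>(g::'a fps) F h K.
        (g, F) \<in> carrier riordan_group \<and> (h, K) \<in> carrier riordan_group \<and>
        finite_order riordan_group (g, F) \<and> finite_order riordan_group (h, K) \<longrightarrow>
          (conjugate_in riordan_group (g, F) (h, K) \<longleftrightarrow>
             fps_nth g 0 = fps_nth h 0 \<and> fps_nth F 1 = fps_nth K 1))"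
proof (rule conjI; intro allI impI)
  fix g F :: "'a fps" and \<omega>
  assume asm: "g \<in> carrier fps_mult_group \<and> F \<in> carrier fps_comp_group \<and> fps_nth F 1 = \<omega> \<and>
    finite_order riordan_group (g, F)"
  then have gF: "(g, F) \<in> carrier riordan_group" and fin: "finite_order riordan_group (g, F)"
    and \<omega>: "\<omega> = fps_nth F 1"
    by (simp_all add: mem_carrier_riordan_group_iff)
  show "conjugate_in riordan_group (g, F) (fps_const (fps_nth g 0), fps_const \<omega> * fps_X) \<and>
          finite_order fps_comp_group F \<and>
          (\<exists>h\<in>carrier fps_mult_group. g = fps_const (fps_nth g 0) * (h / (h oo F))) \<and>
          (\<forall>h\<in>carrier fps_mult_group. g = fps_const (fps_nth g 0) * (h / (h oo F)) \<longrightarrow>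
             (h, riordan_Sigma F) \<in> carrier riordan_group \<and>
             inv\<^bsub>riordan_group\<^esub> (h, riordan_Sigma F)
               \<otimes>\<^bsub>riordan_group\<^esub> (g, F)
               \<otimes>\<^bsub>riordan_group\<^esub> (h, riordan_Sigma F)
             = (fps_const (fps_nth g 0), fps_const \<omega> * fps_X))"
  proof (intro conjI ballI impI)
    show "conjugate_in riordan_group (g, F) (fps_const (fps_nth g 0), fps_const \<omega> * fps_X)"
      unfolding \<omega> by (rule conjugate_to_linear[OF gF fin])
    show "finite_order fps_comp_group F"
      by (rule finite_order_riordan_imp_comp[OF gF fin])
    show "\<exists>h\<in>carrier fps_mult_group. g = fps_const (fps_nth g 0) * (h / (h oo F))"
      using multiplier_exists[OF gF fin] multiplier_equation_iff by metis
  next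
    fix h
    assume h: "h \<in> carrier fps_mult_group" and "g = fps_const (fps_nth g 0) * (h / (h oo F))"
    then have eq: "g * (h oo F) = fps_const (fps_nth g 0) * h"
      using multiplier_equation_iff[OF h] by blast
    show "(h, riordan_Sigma F) \<in> carrier riordan_group"
      by (rule conj_by_Sigma(1)[OF gF fin h eq])
    show "inv\<^bsub>riordan_group\<^esub> (h, riordan_Sigma F) \<otimes>\<^bsub>riordan_group\<^esub> (g, F)
            \<otimes>\<^bsub>riordan_group\<^esub> (h, riordan_Sigma F)
          = (fps_const (fps_nth g 0), fps_const \<omega> * fps_X)"
      unfolding \<omega> by (rule conj_by_Sigma(2)[OF gF fin h eq])
  qed
qed (use conjugate_iff_leading_coeffs_eq in blast)

end
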